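(* Let $K$ be a compact Hausdorff space, $\varphi\colon K\to K$ a continuous map, and $T_\varphi$ the Koopman operator on $\mathrm{C}(K)$. Let $L$ be a compact Hausdorff space such that $\operatorname{fix} T_\varphi\cong \mathrm{C}(L)$ (isomorphism of $C^*$-algebras). Then there is an ordinal number $\alpha$ such that $L$ is homeomorphic to the quotient space $K/{\sim_\alpha}$ (with the quotient topology), where $\sim_\alpha$ is the equivalence relation of degree $\alpha$ associated with $(K;\varphi)$.
   Context: $\mathrm{C}(K)$ is the $C^*$-algebra of continuous complex-valued functions on $K$; the Koopman operator is $T_\varphi f:=f\circ\varphi$ for $f\in\mathrm{C}(K)$, and $\operatorname{fix}T_\varphi:=\{f\in\mathrm{C}(K): T_\varphi f=f\}$, which is a $C^*$-subalgebra of $\mathrm{C}(K)$. $\mathcal{U}(x)$ denotes the neighborhood filter of $x$ (neighborhoods need not be open). For a family $(K_x)_{x\in K}$ of subsets of $K$ with $x\in K_x$ for all $x$, the equivalence relation generated by $(K_x)_{x\in K}$ is: $x\sim y$ iff there are $k\in\mathbb{N}$ and $x_1,\dots,x_k\in K$ with $x_1=x$, $x_k=y$ and $K_{x_i}\cap K_{x_{i+1}}\neq\emptyset$ for $i=1,\dots,k-1$. For every ordinal $\gamma$ and $x\in K$ define by transfinite recursion the approximating orbit $\operatorname{aorb}_\gamma(x)\subseteq K$, the equivalence relation $\sim_\gamma$ on $K$ and the superorbit $\operatorname{sorb}_\gamma(x)\subseteq K$ as follows. Base case: $\operatorname{aorb}_0(x):=\bigcap\{U: U\in\mathcal{U}(x)\text{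 closed},\ \varphi(U)\subseteq U\}$. Successor case $\gamma=\beta+1$: $\operatorname{aorb}_{\gamma}(x):=\bigcap\{\overline{U}^{\operatorname{sorb}_{\beta}}: U\in\mathcal{U}(x)\text{ open},\ \operatorname{sorb}_{\beta}(U)\subseteq U\}$, where $\operatorname{sorb}_\beta(S):=\bigcup_{y\in S}\operatorname{sorb}_\beta(y)$ for $S\subseteq K$ and $\overline{U}^{\operatorname{sorb}_\beta}:=\bigcap\{F: F\in\mathcal{U}(x)\text{ closed},\ U\subseteq F,\ \operatorname{sorb}_\beta(F)\subseteq F\}$. Limit case ($\gamma\neq0$ a limit ordinal): $\operatorname{aorb}_\gamma(x):=\bigcup_{\beta<\gamma}\operatorname{sorb}_\beta(x)$. In all cases $\sim_\gamma$ is the equivalence relation generated by $(\operatorname{aorb}_\gamma(x))_{x\in K}$, $\pi_\gamma\colon K\to K/{\sim_\gamma}$ is the canonical projection, and $\operatorname{sorb}_\gamma(x):=\pi_\gamma^{-1}([x])=\bigcup_{y\sim_\gamma x}\operatorname{aorb}_\gamma(y)$, i.e. the $\sim_\gamma$-equivalence class of $x$ as a subset of $K$. *)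

theory Defs
  imports "HOL-Analysis.Analysis"
begin

section \<open>Algebras of continuous functions and the Koopman operator\<close>

text \<open>
  Spaces are topologies on carriers \<^term>\<open>topspace X\<close>. An element of C(X) is represented by its
  extension by zero outside the carrier, so that distinct continuous functions on the carrier
  have distinct representatives and the algebra operations of C(X) are the pointwise ones.
\<close>

definition cfun :: "'a topology \<Rightarrow> ('a \<Rightarrow> complex) set" where
  "cfun X = {f. continuous_map X euclidean f \<and> (\<forall>x. x \<notin> topspace X \<longrightarrow> f x = 0)}"

definition koopman :: "'a topology \<Rightarrow> ('a \<Rightarrow> 'a) \<Rightarrow> ('a \<Rightarrow> complex) \<Rightarrow> 'a \<Rightarrow> complex" where
  "koopman X \<phi> f = (\<lambda>x. if x \<in> topspace X then f (\<phi> x) else 0)"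

definition fix_koopman :: "'a topology \<Rightarrow> ('a \<Rightarrow> 'a) \<Rightarrow> ('a \<Rightarrow> complex) set" where
  "fix_koopman X \<phi> = {f \<in> cfun X. koopman X \<phi> f = f}"

text \<open>
  Isomorphism of C*-algebras of functions: a bijective *-homomorphism. Such a map is
  automatically isometric and, if the algebras have units, unital.
\<close>

definition star_isomorphism ::
    "('a \<Rightarrow> complex) set \<Rightarrow> ('b \<Rightarrow> complex) set \<Rightarrow> (('a \<Rightarrow> complex) \<Rightarrow> 'b \<Rightarrow> complex) \<Rightarrow> bool" where
  "star_isomorphism A B \<Phi> \<longleftrightarrow>
     bij_betw \<Phi> A B \<and>
     (\<forall>f\<in>A. \<forall>g\<in>A. \<Phi> (\<lambda>x. f x + g x) = (\<lambda>y. \<Phi> f y + \<Phi> g y)) \<and>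
     (\<forall>c. \<forall>f\<in>A. \<Phi> (\<lambda>x. c * f x) = (\<lambda>y. c * \<Phi> f y)) \<and>
     (\<forall>f\<in>A. \<forall>g\<in>A. \<Phi> (\<lambda>x. f x * g x) = (\<lambda>y. \<Phi> f y * \<Phi> g y)) \<and>
     (\<forall>f\<in>A. \<Phi> (\<lambda>x. cnj (f x)) = (\<lambda>y. cnj (\<Phi> f y)))"

definition star_isomorphic :: "('a \<Rightarrow> complex) set \<Rightarrow> ('b \<Rightarrow> complex) set \<Rightarrow> bool" where
  "star_isomorphic A B \<longleftrightarrow> (\<exists>\<Phi>. star_isomorphism A B \<Phi>)"

section \<open>Quotient spaces\<close>

definition quotient_topology :: "'a topology \<Rightarrow> 'a rel \<Rightarrow> 'a set topology" where
  "quotient_topology X R =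
     topology (\<lambda>W. W \<subseteq> topspace X // R \<and> openin X {x \<in> topspace X. R `` {x} \<in> W})"

lemma openin_quotient_topology:
  "openin (quotient_topology X R) W \<longleftrightarrow>
     W \<subseteq> topspace X // R \<and> openin X {x \<in> topspace X. R `` {x} \<in> W}"
proof -
  have "istopology (\<lambda>W. W \<subseteq> topspace X // R \<and> openin X {x \<in> topspace X. R `` {x} \<in> W})"
    unfolding istopology_def
  proof (intro conjI allI impI; (elim conjE)?)
    fix S T
    assume "openin X {x \<in> topspace X. R `` {x} \<in> S}" "openin X {x \<in> topspace X. R `` {x} \<in> T}"
    moreover have "{x \<in> topspace X. R `` {x} \<in> S \<inter> T} =
        {x \<in> topspace X. R `` {x} \<in> S} \<inter> {x \<in> topspace X. R `` {x} \<in> T}" by blast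
    ultimately show "openin X {x \<in> topspace X. R `` {x} \<in> S \<inter> T}" by auto
  next
    fix \<K>
    assume "\<forall>S\<in>\<K>. S \<subseteq> topspace X // R \<and> openin X {x \<in> topspace X. R `` {x} \<in> S}"
    moreover have "{x \<in> topspace X. R `` {x} \<in> \<Union>\<K>} =
        (\<Union>S\<in>\<K>. {x \<in> topspace X. R `` {x} \<in> S})" by blast
    ultimately show "openin X {x \<in> topspace X. R `` {x} \<in> \<Union>\<K>}" by auto
  qed blast+
  then show ?thesis
    unfolding quotient_topology_def by (simp add: topology_inverse')
qed

lemma topspace_quotient_topology: "topspace (quotient_topology X R) = topspace X // R"
proof
  show "topspace (quotient_topology X R) \<subseteq> topspace X // R"
    by (metis openin_quotient_topology openin_topspace)
  have "{x \<in> topspace X. R `` {x} \<in> topspace X // R} = topspace X"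
    by (auto intro: quotientI)
  then have "openin (quotient_topology X R) (topspace X // R)"
    by (simp add: openin_quotient_topology)
  then show "topspace X // R \<subseteq> topspace (quotient_topology X R)"
    by (rule openin_subset)
qed

lemma quotient_map_quotient_topology:
  "quotient_map X (quotient_topology X R) (\<lambda>x. R `` {x})"
  by (auto simp: quotient_map_def topspace_quotient_topology openin_quotient_topology quotient_def)

section \<open>Superorbits\<close>

definition nbhds_of :: "'a topology \<Rightarrow> 'a \<Rightarrow> 'a set set" where
  "nbhds_of X x = {U. U \<subseteq> topspace X \<and> (\<exists>V. openin X V \<and> x \<in> V \<and> V \<subseteq> U)}"

definition generated_equiv :: "'a topology \<Rightarrow> ('a \<Rightarrow> 'a set) \<Rightarrow> 'a rel" where
  "generated_equiv X A =
     {(x, y). \<exists>k\<ge>1. \<exists>c :: nat \<Rightarrow> 'a.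
        (\<forall>i\<in>{1..k}. c i \<in> topspace X) \<and> c 1 = x \<and> c k = y \<and>
        (\<forall>i\<in>{1..<k}. A (c i) \<inter> A (c (i + 1)) \<noteq> {})}"

lemma generated_equivI:
  fixes k :: nat
  assumes "k \<ge> 1" "\<And>i. i \<in> {1..k} \<Longrightarrow> c i \<in> topspace X" "c 1 = x" "c k = y"
    and "\<And>i. i \<in> {1..<k} \<Longrightarrow> A (c i) \<inter> A (c (i + 1)) \<noteq> {}"
  shows "(x, y) \<in> generated_equiv X A"
  unfolding generated_equiv_def mem_Collect_eq case_prod_conv
  by (rule exI[of _ k], intro conjI assms(1) exI[of _ c] assms(3,4) ballI assms(2,5))

lemma generated_equivE:
  assumes "(x, y) \<in> generated_equiv X A"
  obtains k :: nat and c where "k \<ge> 1" "\<forall>i\<in>{1..k}. c i \<in> topspace X" "c 1 = x" "c k = y"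
    "\<forall>i\<in>{1..<k}. A (c i) \<inter> A (c (i + 1)) \<noteq> {}"
  using assms unfolding generated_equiv_def mem_Collect_eq case_prod_conv
  by blast

lemma equiv_generated_equiv:
  assumes "\<And>x. x \<in> topspace X \<Longrightarrow> x \<in> A x"
  shows "equiv (topspace X) (generated_equiv X A)"
proof (rule equivI)
  show "generated_equiv X A \<subseteq> topspace X \<times> topspace X"
    by (force simp: generated_equiv_def)
  show "refl_on (topspace X) (generated_equiv X A)"
    unfolding refl_on_def generated_equiv_def
    by (auto intro!: exI[of _ "1::nat"])
  show "sym (generated_equiv X A)"
  proof (rule symI)
    fix x y assume "(x, y) \<in> generated_equiv X A"
    then obtain k :: nat and c where k: "k \<ge> 1" and c: "\<forall>i\<in>{1..k}. c i \<in> topspace X" "c 1 = x" "c k = y"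
      and A: "\<forall>i\<in>{1..<k}. A (c i) \<inter> A (c (i + 1)) \<noteq> {}"
      by (rule generated_equivE)
    define d where "d i = c (k + 1 - i)" for i
    have "A (d i) \<inter> A (d (i + 1)) \<noteq> {}" if "i \<in> {1..<k}" for i
    proof -
      from that have "k - i \<in> {1..<k}" "k + 1 - i = k - i + 1" by auto
      with A have "A (c (k - i)) \<inter> A (c (k + 1 - i)) \<noteq> {}" by metis
      then show ?thesis by (simp add: d_def Int_commute)
    qed
    moreover have "d i \<in> topspace X" if "i \<in> {1..k}" for i
    proof -
      from that have "k + 1 - i \<in> {1..k}" by auto
      with c(1) show ?thesis unfolding d_def by blast
    qed
    moreover have "d 1 = y" "d k = x"
      using c(2,3) by (auto simp: d_def)
    ultimately show "(y, x) \<in> generated_equiv X A"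
      using k by (intro generated_equivI[of k d]) auto
  qed
  show "trans (generated_equiv X A)"
  proof (rule transI)
    fix x y z assume xy: "(x, y) \<in> generated_equiv X A" and yz: "(y, z) \<in> generated_equiv X A"
    from xy obtain k :: nat and c where k: "k \<ge> 1" and c: "\<forall>i\<in>{1..k}. c i \<in> topspace X" "c 1 = x" "c k = y"
      and A: "\<forall>i\<in>{1..<k}. A (c i) \<inter> A (c (i + 1)) \<noteq> {}"
      by (rule generated_equivE)
    from yz obtain l :: nat and d where l: "l \<ge> 1" and d: "\<forall>i\<in>{1..l}. d i \<in> topspace X" "d 1 = y" "d l = z"
      and B: "\<forall>i\<in>{1..<l}. A (d i) \<inter> A (d (i + 1)) \<noteq> {}"
      by (rule generated_equivE)
    define e where "e i = (if i \<le> k then c i else d (i - k))" for i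
    have y: "y \<in> A y" using assms c(1,3) k by auto
    have "A (e i) \<inter> A (e (i + 1)) \<noteq> {}" if i: "i \<in> {1..<k + l}" for i
    proof -
      consider "i < k" | "i = k" | "i > k" by linarith
      then show ?thesis
      proof cases
        case 1
        then show ?thesis using A i by (auto simp: e_def)
      next
        case 2
        then show ?thesis using y c d by (auto simp: e_def)
      next
        case 3
        then have "i - k \<in> {1..<l}" "i + 1 - k = i - k + 1" using i by auto
        then show ?thesis using B 3 by (auto simp: e_def)
      qed
    qed
    moreover have "e i \<in> topspace X" if i: "i \<in> {1..k + l}" for i
    proof (cases "i \<le> k")
      case True
      then show ?thesis using c(1) i by (auto simp: e_def)
    next
      case False
      then have "i - k \<in> {1..l}" using i by auto
      then show ?thesis using d(1) False by (auto simp: e_def)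
    qed
    moreover have "e 1 = x" "e (k + l) = z" "k + l \<ge> 1"
      using c d k l by (auto simp: e_def)
    ultimately show "(x, z) \<in> generated_equiv X A"
      by (intro generated_equivI[of "k + l" e]) auto
  qed
qed

definition aorb_base :: "'a topology \<Rightarrow> ('a \<Rightarrow> 'a) \<Rightarrow> 'a \<Rightarrow> 'a set" where
  "aorb_base X \<phi> x = \<Inter>{U. U \<in> nbhds_of X x \<and> closedin X U \<and> \<phi> ` U \<subseteq> U}"

text \<open>
  In the next two definitions \<^term>\<open>s\<close> is the map sending a point to its superorbit of the
  preceding degree. The closure depends on \<^term>\<open>x\<close>, since F ranges over neighborhoods of
  \<^term>\<open>x\<close>.
\<close>

definition sorb_closure :: "'a topology \<Rightarrow> ('a \<Rightarrow> 'a set) \<Rightarrow> 'a \<Rightarrow> 'a set \<Rightarrow> 'a set" where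
  "sorb_closure X s x U =
     \<Inter>{F. F \<in> nbhds_of X x \<and> closedin X F \<and> U \<subseteq> F \<and> (\<Union>y\<in>F. s y) \<subseteq> F}"

definition aorb_succ :: "'a topology \<Rightarrow> ('a \<Rightarrow> 'a set) \<Rightarrow> 'a \<Rightarrow> 'a set" where
  "aorb_succ X s x =
     \<Inter>{sorb_closure X s x U | U. U \<in> nbhds_of X x \<and> openin X U \<and> (\<Union>y\<in>U. s y) \<subseteq> U}"

text \<open>
  An ordinal is given by a well-order \<^term>\<open>r\<close> (reflexive, as in the library) and an element
  \<^term>\<open>\<gamma>\<close> of its field: it is the order type of \<^term>\<open>underS r \<gamma>\<close>, the set of strict
  predecessors of \<^term>\<open>\<gamma>\<close>. Thus it is 0 iff there are no predecessors, and the successor of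
  the ordinal given by \<^term>\<open>\<beta>\<close> iff \<^term>\<open>\<beta>\<close> is the largest predecessor.
\<close>

definition is_succ_of :: "'o rel \<Rightarrow> 'o \<Rightarrow> 'o \<Rightarrow> bool" where
  "is_succ_of r \<gamma> \<beta> \<longleftrightarrow> \<beta> \<in> underS r \<gamma> \<and> (\<forall>\<delta>\<in>underS r \<gamma>. (\<delta>, \<beta>) \<in> r)"

definition aorb_step ::
    "'a topology \<Rightarrow> ('a \<Rightarrow> 'a) \<Rightarrow> 'o rel \<Rightarrow> ('o \<Rightarrow> 'a \<Rightarrow> 'a set) \<Rightarrow> 'o \<Rightarrow> 'a \<Rightarrow> 'a set" where
  "aorb_step X \<phi> r s \<gamma> =
     (if underS r \<gamma> = {} then aorb_base X \<phi>
      else if \<exists>\<beta>. is_succ_of r \<gamma> \<beta> then aorb_succ X (s (THE \<beta>. is_succ_of r \<gamma> \<beta>))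
      else (\<lambda>x. \<Union>\<beta>\<in>underS r \<gamma>. s \<beta> x))"

definition sorb :: "'a topology \<Rightarrow> ('a \<Rightarrow> 'a) \<Rightarrow> 'o rel \<Rightarrow> 'o \<Rightarrow> 'a \<Rightarrow> 'a set" where
  "sorb X \<phi> r = wo_rel.worec r (\<lambda>s \<gamma> x. generated_equiv X (aorb_step X \<phi> r s \<gamma>) `` {x})"

definition aorb :: "'a topology \<Rightarrow> ('a \<Rightarrow> 'a) \<Rightarrow> 'o rel \<Rightarrow> 'o \<Rightarrow> 'a \<Rightarrow> 'a set" where
  "aorb X \<phi> r \<gamma> = aorb_step X \<phi> r (sorb X \<phi> r) \<gamma>"

definition orb_equiv :: "'a topology \<Rightarrow> ('a \<Rightarrow> 'a) \<Rightarrow> 'o rel \<Rightarrow> 'o \<Rightarrow> 'a rel" where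
  "orb_equiv X \<phi> r \<gamma> = generated_equiv X (aorb X \<phi> r \<gamma>)"

lemma is_succ_of_unique:
  assumes "Well_order r" "is_succ_of r \<gamma> \<beta>" "is_succ_of r \<gamma> \<beta>'"
  shows "\<beta> = \<beta>'"
proof -
  have "antisym r" using assms(1) by (simp add: order_on_defs)
  with assms(2,3) show ?thesis unfolding is_succ_of_def antisym_def by blast
qed

lemma the_is_succ_of:
  assumes "Well_order r" "is_succ_of r \<gamma> \<beta>"
  shows "(THE \<beta>. is_succ_of r \<gamma> \<beta>) = \<beta>"
  using assms is_succ_of_unique by (metis the_equality)

lemma sorb_eq:
  assumes "Well_order r"
  shows "sorb X \<phi> r \<gamma> x = orb_equiv X \<phi> r \<gamma> `` {x}"
proof -
  have wo: "wo_rel r" using assms by (simp add: wo_rel_def)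
  have step: "aorb_step X \<phi> r s \<delta> = aorb_step X \<phi> r s' \<delta>"
    if eq: "\<forall>\<beta>\<in>underS r \<delta>. s \<beta> = s' \<beta>" for s s' \<delta>
  proof -
    have "s (THE \<beta>. is_succ_of r \<delta> \<beta>) = s' (THE \<beta>. is_succ_of r \<delta> \<beta>)"
      if "is_succ_of r \<delta> \<beta>" for \<beta>
      using the_is_succ_of[OF assms that] that eq by (simp add: is_succ_of_def)
    then show ?thesis using eq by (auto simp: aorb_step_def)
  qed
  have "wo_rel.adm_wo r (\<lambda>s \<gamma> x. generated_equiv X (aorb_step X \<phi> r s \<gamma>) `` {x})"
    unfolding wo_rel.adm_wo_def[OF wo] using step by metis
  from wo_rel.worec_fixpoint[OF wo this]
  have "sorb X \<phi> r = (\<lambda>\<gamma> x. generated_equiv X (aorb_step X \<phi> r (sorb X \<phi> r) \<gamma>) `` {x})"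
    unfolding sorb_def by simp
  then show ?thesis unfolding orb_equiv_def aorb_def by metis
qed

lemma aorb_zero: "underS r \<gamma> = {} \<Longrightarrow> aorb X \<phi> r \<gamma> x = aorb_base X \<phi> x"
  by (simp add: aorb_def aorb_step_def)

lemma aorb_successor:
  assumes "Well_order r" "is_succ_of r \<gamma> \<beta>"
  shows "aorb X \<phi> r \<gamma> x = aorb_succ X (sorb X \<phi> r \<beta>) x"
proof -
  have "underS r \<gamma> \<noteq> {}" using assms(2) by (auto simp: is_succ_of_def)
  moreover have "\<exists>\<beta>. is_succ_of r \<gamma> \<beta>" using assms(2) by blast
  ultimately show ?thesis
    by (simp add: aorb_def aorb_step_def the_is_succ_of[OF assms])
qed

lemma aorb_limit:
  assumes "underS r \<gamma> \<noteq> {}" "\<nexists>\<beta>. is_succ_of r \<gamma> \<beta>"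
  shows "aorb X \<phi> r \<gamma> x = (\<Union>\<beta>\<in>underS r \<gamma>. sorb X \<phi> r \<beta> x)"
  unfolding aorb_def aorb_step_def if_not_P[OF assms(1)] if_not_P[OF assms(2)] by (rule refl)

end

theory Submission
  imports Defs
begin

text \<open>
  Call two points of \<^term>\<open>K\<close> equivalent if every invariant continuous function takes the same
  value at both. This relation \<open>fix_equiv\<close> is the common target of two arguments.

  The first identifies \<^term>\<open>L\<close> with the quotient of \<^term>\<open>K\<close> by \<open>fix_equiv\<close>. Every unital
  character of the algebra of invariant functions is evaluation at a point of \<^term>\<open>K\<close>
  (\<open>character_is_point_evaluation\<close>), and the same holds for C(L), which is the algebra of functions
  invariant under the identity. Reading the isomorphism backwards, each point of \<^term>\<open>K\<close> induces a
  character of C(L), hence a point of \<^term>\<open>L\<close>; the resulting map is continuous and closed, its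
  fibres are the classes of \<open>fix_equiv\<close>, and reading the isomorphism forwards shows that it is onto
  (\<open>gelfand_space_homeomorphic_quotient\<close>).

  The second shows that the transfinite recursion arrives at \<open>fix_equiv\<close>. All relations of the
  recursion lie below \<open>fix_equiv\<close>, because an invariant function that separates two points yields
  closed and open sublevel sets which the approximating orbits respect. They increase with the
  degree. If a degree is not enlarged by the successor step, the successor step says exactly that
  distinct classes are separated by a saturated open set and the complement of a larger saturated
  closed set, so the quotient is Hausdorff (\<open>next_equiv_stable_imp_Hausdorff\<close>); Urysohn functions
  on this compact Hausdorff quotient pull back to invariant functions, so the relation has already
  become \<open>fix_equiv\<close> (\<open>fix_equiv_subset_stable_equiv\<close>). Otherwise each degree contributes a pair
  that is new at the next step. Different degrees contribute different pairs, so the degrees inject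
  into the pairs of points, which Cantor's theorem excludes for a well-order on all sets of pairs
  (\<open>orb_equiv_reaches_fix_equiv\<close>).
\<close>

section \<open>The algebra of invariant functions\<close>

lemma continuous_map_comp_continuous_on:
  assumes "continuous_map X euclidean f" "continuous_on UNIV F"
  shows "continuous_map X euclidean (\<lambda>x. F (f x))"
  using continuous_map_compose[of X euclidean f euclidean F] assms by (simp add: o_def)

lemma continuous_map_complex_mult:
  fixes f g :: "'a \<Rightarrow> complex"
  shows "continuous_map X euclidean f \<Longrightarrow> continuous_map X euclidean g \<Longrightarrow>
    continuous_map X euclidean (\<lambda>x. f x * g x)"
  by (simp add: continuous_map_atin tendsto_mult)

lemma continuous_map_complex_inverse:
  fixes f :: "'a \<Rightarrow> complex"
  shows "continuous_map X euclidean f \<Longrightarrow> (\<And>x. x \<in> topspace X \<Longrightarrow> f x \<noteq> 0) \<Longrightarrow>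
    continuous_map X euclidean (\<lambda>x. inverse (f x))"
  by (simp add: continuous_map_atin tendsto_inverse)

definition unit_fun :: "'a topology \<Rightarrow> 'a \<Rightarrow> complex" where
  "unit_fun X = (\<lambda>x. if x \<in> topspace X then 1 else 0)"

lemma fix_koopman_iff:
  "f \<in> fix_koopman X \<phi> \<longleftrightarrow> continuous_map X euclidean f \<and> (\<forall>x. x \<notin> topspace X \<longrightarrow> f x = 0) \<and>
    (\<forall>x\<in>topspace X. f (\<phi> x) = f x)"
  by (auto simp: fix_koopman_def cfun_def koopman_def fun_eq_iff)

text \<open>
  This lets facts about invariant functions serve for all of C(L) as well, so that the
  isomorphism can be used in both directions.
\<close>

lemma cfun_eq_fix_koopman_id: "cfun X = fix_koopman X id"
  by (auto simp: fix_koopman_iff cfun_def)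

lemma fix_koopman_add:
  "f \<in> fix_koopman X \<phi> \<Longrightarrow> g \<in> fix_koopman X \<phi> \<Longrightarrow> (\<lambda>x. f x + g x) \<in> fix_koopman X \<phi>"
  by (simp add: fix_koopman_iff continuous_map_add)

lemma fix_koopman_mult:
  "f \<in> fix_koopman X \<phi> \<Longrightarrow> g \<in> fix_koopman X \<phi> \<Longrightarrow> (\<lambda>x. f x * g x) \<in> fix_koopman X \<phi>"
  by (simp add: fix_koopman_iff continuous_map_complex_mult)

lemma fix_koopman_scale:
  "f \<in> fix_koopman X \<phi> \<Longrightarrow> (\<lambda>x. c * f x) \<in> fix_koopman X \<phi>"
  by (simp add: fix_koopman_iff continuous_map_complex_mult)

lemma fix_koopman_cnj:
  "f \<in> fix_koopman X \<phi> \<Longrightarrow> (\<lambda>x. cnj (f x)) \<in> fix_koopman X \<phi>"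
  by (auto simp: fix_koopman_iff intro!: continuous_map_comp_continuous_on[of _ _ cnj] continuous_intros)

lemma fix_koopman_inverse:
  "f \<in> fix_koopman X \<phi> \<Longrightarrow> (\<And>x. x \<in> topspace X \<Longrightarrow> f x \<noteq> 0) \<Longrightarrow>
    (\<lambda>x. inverse (f x)) \<in> fix_koopman X \<phi>"
  by (simp add: fix_koopman_iff continuous_map_complex_inverse)

lemma fix_koopman_unit:
  assumes "\<phi> \<in> topspace X \<rightarrow> topspace X"
  shows "unit_fun X \<in> fix_koopman X \<phi>"
proof -
  have "continuous_map X euclidean (unit_fun X)"
    by (rule continuous_map_eq[of _ _ "\<lambda>x. 1"]) (auto simp: unit_fun_def)
  then show ?thesis using assms by (auto simp: fix_koopman_iff unit_fun_def)
qed

section \<open>Characters of the invariant functions\<close>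

text \<open>
  If no point represented the character, its kernel would contain, for each point, a function that
  is nonnegative everywhere and positive at that point. By compactness finitely many of them add
  up to a function without zeros. That function is invertible in the algebra, which is impossible
  for an element of the kernel.
\<close>

lemma character_is_point_evaluation:
  fixes \<omega> :: "('a \<Rightarrow> complex) \<Rightarrow> complex"
  assumes comp: "compact_space X" and \<phi>: "\<phi> \<in> topspace X \<rightarrow> topspace X"
    and add: "\<And>f g. f \<in> fix_koopman X \<phi> \<Longrightarrow> g \<in> fix_koopman X \<phi> \<Longrightarrow> \<omega> (\<lambda>x. f x + g x) = \<omega> f + \<omega> g"
    and mult: "\<And>f g. f \<in> fix_koopman X \<phi> \<Longrightarrow> g \<in> fix_koopman X \<phi> \<Longrightarrow> \<omega> (\<lambda>x. f x * g x) = \<omega> f * \<omega> g"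
    and scale: "\<And>c f. f \<in> fix_koopman X \<phi> \<Longrightarrow> \<omega> (\<lambda>x. c * f x) = c * \<omega> f"
    and unit: "\<omega> (unit_fun X) = 1"
  shows "\<exists>x\<in>topspace X. \<forall>f\<in>fix_koopman X \<phi>. \<omega> f = f x"
proof (rule ccontr)
  assume neg: "\<not> ?thesis"
  let ?A = "fix_koopman X \<phi>"
  note unitA = fix_koopman_unit[OF \<phi>]
  define N where "N = {h \<in> ?A. \<omega> h = 0 \<and> (\<forall>x\<in>topspace X. 0 \<le> h x)}"
  have pos: "\<exists>h\<in>N. h x \<noteq> 0" if x: "x \<in> topspace X" for x
  proof -
    (* The kernel element f - omega(f) does not vanish at x; g * cnj g makes it nonnegative. *)
    from neg x have "\<exists>f\<in>?A. \<omega> f \<noteq> f x" by simp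
    then obtain f where f: "f \<in> ?A" "\<omega> f \<noteq> f x" by (rule bexE)
    define g where "g = (\<lambda>z. f z + (- \<omega> f) * unit_fun X z)"
    have g: "g \<in> ?A" unfolding g_def by (rule fix_koopman_add[OF f(1) fix_koopman_scale[OF unitA]])
    have "\<omega> g = \<omega> f + \<omega> (\<lambda>z. (- \<omega> f) * unit_fun X z)"
      unfolding g_def by (rule add[OF f(1) fix_koopman_scale[OF unitA]])
    also have "\<dots> = 0" unfolding scale[OF unitA] unit by simp
    finally have "\<omega> g = 0" .
    then have "\<omega> (\<lambda>z. g z * cnj (g z)) = 0"
      using mult[OF g fix_koopman_cnj[OF g]] by simp
    moreover have "g x \<noteq> 0" using f(2) x by (auto simp: g_def unit_fun_def)
    moreover have "0 \<le> g z * cnj (g z)" for z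
      by (simp add: complex_mult_cnj less_eq_complex_def)
    ultimately have "(\<lambda>z. g z * cnj (g z)) \<in> N" "g x * cnj (g x) \<noteq> 0"
      using fix_koopman_mult[OF g fix_koopman_cnj[OF g]] by (simp_all add: N_def)
    then show ?thesis by (intro bexI[of _ "\<lambda>z. g z * cnj (g z)"])
  qed
  then obtain H where H: "\<And>x. x \<in> topspace X \<Longrightarrow> H x \<in> N \<and> H x x \<noteq> 0" by metis
  define U where "U x = {z \<in> topspace X. H x z \<noteq> 0}" for x
  have U_open: "openin X (U x)" if x: "x \<in> topspace X" for x
  proof -
    have "H x \<in> ?A" using H[OF x] by (simp add: N_def)
    then have "continuous_map X euclidean (H x)" by (simp add: fix_koopman_iff)
    then have "openin X {z \<in> topspace X. H x z \<in> - {0}}"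
      by (rule openin_continuous_map_preimage) (simp add: open_Compl)
    then show ?thesis by (simp add: U_def)
  qed
  have "compactin X (topspace X)" using comp by (simp add: compact_space_def)
  moreover have "topspace X \<subseteq> \<Union>(U ` topspace X)" using H by (force simp: U_def)
  ultimately have "\<exists>\<F>. finite \<F> \<and> \<F> \<subseteq> U ` topspace X \<and> topspace X \<subseteq> \<Union>\<F>"
    using U_open by (intro compactinD) auto
  then obtain \<F> where \<F>: "finite \<F>" "\<F> \<subseteq> U ` topspace X" "topspace X \<subseteq> \<Union>\<F>"
    by (elim exE conjE)
  then obtain D where D: "D \<subseteq> topspace X" "finite D" "\<F> = U ` D"
    using finite_subset_image[OF \<F>(1,2)] by (elim exE conjE)
  have "\<exists>h\<in>N. \<forall>z\<in>topspace X. (\<exists>x\<in>D. H x z \<noteq> 0) \<longrightarrow> h z \<noteq> 0"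
    using D(2,1)
  proof (induction D)
    case empty
    have "\<omega> (\<lambda>z. 0 * unit_fun X z) = 0" using scale[OF unitA, of 0] by simp
    with fix_koopman_scale[OF unitA, of 0] have "(\<lambda>z. 0) \<in> N" by (simp add: N_def)
    then show ?case by (intro bexI[of _ "\<lambda>z. 0"]) simp_all
  next
    case (insert x D)
    then obtain h where h: "h \<in> N" "\<forall>z\<in>topspace X. (\<exists>x\<in>D. H x z \<noteq> 0) \<longrightarrow> h z \<noteq> 0"
      by (metis insert_subset)
    have Hx: "H x \<in> N" using H[of x] insert.prems by simp
    let ?k = "\<lambda>z. h z + H x z"
    have hA: "h \<in> ?A" "H x \<in> ?A" using h(1) Hx by (simp_all add: N_def)
    have nonneg: "0 \<le> h z" "0 \<le> H x z" if "z \<in> topspace X" for z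
      using h(1) Hx that by (simp_all add: N_def)
    have "?k \<in> N"
      using fix_koopman_add[OF hA] add[OF hA] h(1) Hx nonneg by (simp add: N_def)
    moreover have "?k z \<noteq> 0" if z: "z \<in> topspace X" "\<exists>y\<in>insert x D. H y z \<noteq> 0" for z
    proof -
      have "h z \<noteq> 0 \<or> H x z \<noteq> 0" using z h(2) by (metis insertE)
      then show ?thesis using add_nonneg_eq_0_iff[OF nonneg[OF z(1)]] by simp
    qed
    ultimately show ?case by (intro bexI[of _ ?k]) simp_all
  qed
  then obtain h where h: "h \<in> N" "\<forall>z\<in>topspace X. (\<exists>x\<in>D. H x z \<noteq> 0) \<longrightarrow> h z \<noteq> 0"
    by (rule bexE)
  have h_nz: "h z \<noteq> 0" if z: "z \<in> topspace X" for z
  proof -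
    have "\<exists>x\<in>D. H x z \<noteq> 0" using z \<F>(3) D(3) by (auto simp: U_def)
    with h(2) z show ?thesis by simp
  qed
  have hA: "h \<in> ?A" and "\<omega> h = 0" using h(1) by (simp_all add: N_def)
  moreover have iA: "(\<lambda>z. inverse (h z)) \<in> ?A" by (rule fix_koopman_inverse[OF hA h_nz])
  moreover have "(\<lambda>z. h z * inverse (h z)) = unit_fun X"
  proof
    fix z
    show "h z * inverse (h z) = unit_fun X z"
      using h_nz[of z] hA by (cases "z \<in> topspace X") (simp_all add: unit_fun_def fix_koopman_iff)
  qed
  ultimately show False using mult[OF hA iA] unit by simp
qed

text \<open>
  Composing an isomorphism with evaluation at a point of the target gives a character. It is
  unital because an isomorphism maps the unit to the unit: the preimage of the unit of the target
  absorbs the unit of the source.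
\<close>

lemma star_isomorphism_fix_koopman_point:
  assumes "compact_space X" and \<phi>: "\<phi> \<in> topspace X \<rightarrow> topspace X"
    and \<psi>: "\<psi> \<in> topspace Y \<rightarrow> topspace Y"
    and iso: "star_isomorphism (fix_koopman X \<phi>) (fix_koopman Y \<psi>) \<Phi>"
    and y: "y \<in> topspace Y"
  shows "\<exists>x\<in>topspace X. \<forall>f\<in>fix_koopman X \<phi>. \<Phi> f y = f x"
proof (rule character_is_point_evaluation[OF assms(1) \<phi>])
  let ?A = "fix_koopman X \<phi>" and ?B = "fix_koopman Y \<psi>"
  have bij: "bij_betw \<Phi> ?A ?B" and
    mult: "\<And>f g. f \<in> ?A \<Longrightarrow> g \<in> ?A \<Longrightarrow> \<Phi> (\<lambda>x. f x * g x) = (\<lambda>y. \<Phi> f y * \<Phi> g y)"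
    using iso by (auto simp: star_isomorphism_def)
  obtain e where e: "e \<in> ?A" "\<Phi> e = unit_fun Y"
    using bij fix_koopman_unit[OF \<psi>] by (metis bij_betw_imp_surj_on imageE)
  have "(\<lambda>x. e x * unit_fun X x) = e"
    using e(1) by (auto simp: fix_koopman_iff unit_fun_def fun_eq_iff)
  then have "\<Phi> e y = \<Phi> e y * \<Phi> (unit_fun X) y"
    using mult[OF e(1) fix_koopman_unit[OF \<phi>]] by metis
  then show "\<Phi> (unit_fun X) y = 1" using y by (simp add: e(2) unit_fun_def)
qed (use iso in \<open>auto simp: star_isomorphism_def\<close>)

lemma star_isomorphism_inv_fix_koopman:
  assumes iso: "star_isomorphism (fix_koopman X \<phi>) B \<Phi>"
  shows "star_isomorphism B (fix_koopman X \<phi>) (inv_into (fix_koopman X \<phi>) \<Phi>)"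
proof -
  let ?A = "fix_koopman X \<phi>" let ?\<Psi> = "inv_into ?A \<Phi>"
  have bij: "bij_betw \<Phi> ?A B" using iso by (simp add: star_isomorphism_def)
  have inA: "?\<Psi> g \<in> ?A" and right: "\<Phi> (?\<Psi> g) = g" if "g \<in> B" for g
    using that bij by (auto simp: bij_betw_def inv_into_into f_inv_into_f)
  have eqI: "?\<Psi> g = f" if "f \<in> ?A" "\<Phi> f = g" for f g
    using that bij by (metis bij_betw_inv_into_left)
  show ?thesis
    unfolding star_isomorphism_def
  proof (intro conjI ballI allI)
    show "bij_betw ?\<Psi> B ?A" using bij by (rule bij_betw_inv_into)
  qed (use iso in \<open>auto intro!: eqI simp: star_isomorphism_def inA right
        fix_koopman_add fix_koopman_mult fix_koopman_scale fix_koopman_cnj\<close>)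
qed

section \<open>Compact Hausdorff spaces and quotients\<close>

lemma cfun_separates_closed:
  assumes "compact_space X" "Hausdorff_space X" "closedin X S" "x \<in> topspace X" "x \<notin> S"
  shows "\<exists>f\<in>cfun X. f x = 0 \<and> (\<forall>z\<in>S. f z = 1)"
proof -
  have "completely_regular_space X"
    using assms by (simp add: normal_imp_completely_regular_space compact_Hausdorff_or_regular_imp_normal_space)
  with assms obtain f :: "'a \<Rightarrow> real" where f: "continuous_map X euclideanreal f" "f x = 0" "f ` S \<subseteq> {1}"
    unfolding completely_regular_space_alt by blast
  let ?g = "\<lambda>z. if z \<in> topspace X then complex_of_real (f z) else 0"
  have "continuous_map X euclidean (\<lambda>z. complex_of_real (f z))"
    by (rule continuous_map_comp_continuous_on[OF f(1)]) (intro continuous_intros)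
  then have "continuous_map X euclidean ?g"
    by (rule continuous_map_eq) auto
  then show ?thesis
    using f closedin_subset[OF assms(3)] by (intro bexI[of _ ?g]) (auto simp: cfun_def)
qed

lemma quotient_maps_same_fibres_homeomorphic:
  assumes f: "quotient_map X Y f" and g: "quotient_map X Z g"
    and fib: "\<And>x y. x \<in> topspace X \<Longrightarrow> y \<in> topspace X \<Longrightarrow> f x = f y \<longleftrightarrow> g x = g y"
  shows "Y homeomorphic_space Z"
proof -
  obtain u where u: "continuous_map Y Z u" "\<And>x. x \<in> topspace X \<Longrightarrow> u (f x) = g x"
    using quotient_map_lift_exists[OF f quotient_imp_continuous_map[OF g]] fib by metis
  obtain v where v: "continuous_map Z Y v" "\<And>x. x \<in> topspace X \<Longrightarrow> v (g x) = f x"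
    using quotient_map_lift_exists[OF g quotient_imp_continuous_map[OF f]] fib by metis
  have "topspace Y = f ` topspace X" "topspace Z = g ` topspace X"
    using f g by (auto simp: quotient_map_def)
  then have "homeomorphic_maps Y Z u v"
    using u v by (auto simp: homeomorphic_maps_def)
  then show ?thesis by (auto simp: homeomorphic_space_def)
qed

definition fix_equiv :: "'a topology \<Rightarrow> ('a \<Rightarrow> 'a) \<Rightarrow> 'a rel" where
  "fix_equiv X \<phi> = {(x, y). x \<in> topspace X \<and> y \<in> topspace X \<and> (\<forall>f\<in>fix_koopman X \<phi>. f x = f y)}"

lemma equiv_fix_equiv: "equiv (topspace X) (fix_equiv X \<phi>)"
  by (rule equivI) (auto simp: fix_equiv_def refl_on_def sym_def trans_def)

text \<open>
  The map \<open>h\<close> sends a point of \<^term>\<open>K\<close> to the point of \<^term>\<open>L\<close> at which the corresponding character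
  of C(L) evaluates. Since C(L) determines both the points and the topology of \<^term>\<open>L\<close>, the
  identity \<open>g (h x) = \<Psi> g x\<close> governs continuity, fibres and surjectivity of \<open>h\<close>.
\<close>

lemma gelfand_space_homeomorphic_quotient:
  assumes K: "compact_space K" and \<phi>: "\<phi> \<in> topspace K \<rightarrow> topspace K"
    and L: "compact_space L" "Hausdorff_space L"
    and iso: "star_isomorphic (fix_koopman K \<phi>) (cfun L)"
  shows "L homeomorphic_space quotient_topology K (fix_equiv K \<phi>)"
proof -
  let ?A = "fix_koopman K \<phi>"
  from iso obtain \<Phi> where \<Phi>: "star_isomorphism ?A (fix_koopman L id) \<Phi>"
    by (auto simp: star_isomorphic_def cfun_eq_fix_koopman_id)
  define \<Psi> where "\<Psi> = inv_into ?A \<Phi>"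
  have \<Psi>: "star_isomorphism (fix_koopman L id) ?A \<Psi>"
    unfolding \<Psi>_def by (rule star_isomorphism_inv_fix_koopman[OF \<Phi>])
  have bij: "bij_betw \<Psi> (cfun L) ?A"
    using \<Psi> by (simp add: star_isomorphism_def cfun_eq_fix_koopman_id)
  have "\<exists>y\<in>topspace L. \<forall>g\<in>cfun L. \<Psi> g x = g y" if "x \<in> topspace K" for x
    using star_isomorphism_fix_koopman_point[OF L(1) _ \<phi> \<Psi> that]
    by (auto simp: cfun_eq_fix_koopman_id)
  then obtain h where h: "\<And>x. x \<in> topspace K \<Longrightarrow> h x \<in> topspace L"
    and h_eval: "\<And>x g. x \<in> topspace K \<Longrightarrow> g \<in> cfun L \<Longrightarrow> \<Psi> g x = g (h x)"
    by metis
  have sep: "y = z" if y: "y \<in> topspace L" and z: "z \<in> topspace L"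
    and eq: "\<And>g. g \<in> cfun L \<Longrightarrow> g y = g z" for y z
  proof (rule ccontr)
    assume "y \<noteq> z"
    moreover have "closedin L {z}" using L(2) z by (simp add: closedin_Hausdorff_singleton)
    ultimately obtain g where "g \<in> cfun L" "g y = 0" "g z = 1"
      using cfun_separates_closed[OF L, of "{z}" y] y by auto
    with eq[of g] show False by simp
  qed
  have fib: "h x = h y \<longleftrightarrow> fix_equiv K \<phi> `` {x} = fix_equiv K \<phi> `` {y}"
    if x: "x \<in> topspace K" and y: "y \<in> topspace K" for x y
  proof -
    have "fix_equiv K \<phi> `` {x} = fix_equiv K \<phi> `` {y} \<longleftrightarrow> (x, y) \<in> fix_equiv K \<phi>"
      using eq_equiv_class_iff[OF equiv_fix_equiv] x y by metis
    also have "\<dots> \<longleftrightarrow> (\<forall>f\<in>\<Psi> ` cfun L. f x = f y)"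
      using x y bij_betw_imp_surj_on[OF bij] by (simp add: fix_equiv_def)
    also have "\<dots> \<longleftrightarrow> (\<forall>g\<in>cfun L. \<Psi> g x = \<Psi> g y)" by simp
    also have "\<dots> \<longleftrightarrow> (\<forall>g\<in>cfun L. g (h x) = g (h y))"
      using h_eval x y by auto
    also have "\<dots> \<longleftrightarrow> h x = h y" using sep h x y by metis
    finally show ?thesis by blast
  qed
  have cont: "continuous_map K L h"
    unfolding continuous_map_def
  proof (intro conjI allI impI)
    show "h \<in> topspace K \<rightarrow> topspace L" using h by blast
    fix W assume W: "openin L W"
    show "openin K {x \<in> topspace K. h x \<in> W}"
    proof (subst openin_subopen, intro ballI)
      fix x assume "x \<in> {x \<in> topspace K. h x \<in> W}"
      then have x: "x \<in> topspace K" "h x \<in> W" by auto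
      obtain g where g: "g \<in> cfun L" "g (h x) = 0" "\<forall>z\<in>topspace L - W. g z = 1"
        using cfun_separates_closed[OF L, of "topspace L - W" "h x"] W x h by auto
      have "\<Psi> g \<in> ?A" using bij g(1) by (auto simp: bij_betw_def)
      then have "continuous_map K euclidean (\<Psi> g)" by (simp add: fix_koopman_iff)
      then have "openin K {z \<in> topspace K. \<Psi> g z \<in> - {1}}"
        by (rule openin_continuous_map_preimage) (simp add: open_Compl)
      moreover have "{z \<in> topspace K. \<Psi> g z \<in> - {1}} \<subseteq> {x \<in> topspace K. h x \<in> W}"
        using g(1,3) h h_eval by fastforce
      moreover have "x \<in> {z \<in> topspace K. \<Psi> g z \<in> - {1}}" using x(1) g(1,2) h_eval by simp
      ultimately show "\<exists>T. openin K T \<and> x \<in> T \<and> T \<subseteq> {x \<in> topspace K. h x \<in> W}" by blast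
    qed
  qed
  (* Evaluation at y, transported to the invariant functions, is evaluation at some x;
     since C(L) separates points, y = h x. *)
  have "y \<in> h ` topspace K" if y: "y \<in> topspace L" for y
  proof -
    obtain x where x: "x \<in> topspace K" "\<forall>f\<in>?A. \<Phi> f y = f x"
      using star_isomorphism_fix_koopman_point[OF K \<phi> _ \<Phi> y] by auto
    have "g y = g (h x)" if g: "g \<in> cfun L" for g
    proof -
      have "\<Phi> (\<Psi> g) = g"
        using \<Phi> g unfolding \<Psi>_def cfun_eq_fix_koopman_id star_isomorphism_def
        by (metis bij_betw_inv_into_right)
      moreover have "\<Psi> g \<in> ?A" using bij g by (auto simp: bij_betw_def)
      ultimately show ?thesis using x h_eval[OF x(1) g] by metis
    qed
    then have "y = h x" using sep y h x(1) by blast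
    then show ?thesis using x(1) by blast
  qed
  then have "h ` topspace K = topspace L" using h by blast
  moreover have "closed_map K L h" by (rule continuous_imp_closed_map[OF cont K L(2)])
  ultimately have "quotient_map K L h"
    using continuous_closed_imp_quotient_map cont by blast
  then show ?thesis
    by (rule quotient_maps_same_fibres_homeomorphic[OF _ quotient_map_quotient_topology]) (rule fib)
qed

section \<open>One step of the transfinite recursion\<close>

lemma generated_equiv_if_mem:
  assumes "x \<in> topspace X" "y \<in> topspace X" "y \<in> A x" "y \<in> A y"
  shows "(x, y) \<in> generated_equiv X A"
  by (rule generated_equivI[of 2 "\<lambda>i. if i = 1 then x else y"]) (use assms in auto)

text \<open>
  Two consecutive points of a chain are related by \<^term>\<open>E\<close> through a common point of their sets.
\<close>

lemma generated_equiv_least: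
  assumes E: "equiv (topspace X) E" and A: "\<And>x. x \<in> topspace X \<Longrightarrow> A x \<subseteq> E `` {x}"
  shows "generated_equiv X A \<subseteq> E"
proof (rule subrelI)
  fix x y assume "(x, y) \<in> generated_equiv X A"
  then obtain k :: nat and c where k: "k \<ge> 1" and c: "\<forall>i\<in>{1..k}. c i \<in> topspace X" "c 1 = x" "c k = y"
    and chain: "\<forall>i\<in>{1..<k}. A (c i) \<inter> A (c (i + 1)) \<noteq> {}"
    by (rule generated_equivE)
  from E have "sym E" "trans E" "refl_on (topspace X) E" by (auto simp: equiv_def)
  have "(c 1, c (Suc i)) \<in> E" if "Suc i \<le> k" for i
    using that
  proof (induction i)
    case 0
    then show ?case using c(1) \<open>refl_on (topspace X) E\<close> by (auto simp: refl_on_def)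
  next
    case (Suc i)
    then obtain z where z: "z \<in> A (c (Suc i))" "z \<in> A (c (Suc (Suc i)))"
      using chain by force
    have "c (Suc i) \<in> topspace X" "c (Suc (Suc i)) \<in> topspace X" using c(1) Suc.prems by auto
    with z A have "(c (Suc i), z) \<in> E" "(c (Suc (Suc i)), z) \<in> E" by auto
    then show ?case
      using Suc.IH Suc.prems \<open>sym E\<close> \<open>trans E\<close> by (meson Suc_leD symD transD)
  qed
  from this[of "k - 1"] show "(x, y) \<in> E" using k c(2,3) by simp
qed

text \<open>
  The successor step of the recursion as an operator on relations, so that stability under it makes
  sense even when the degree in question has no successor in the chosen well-order.
\<close>

definition next_equiv :: "'a topology \<Rightarrow> 'a rel \<Rightarrow> 'a rel" where
  "next_equiv X R = generated_equiv X (aorb_succ X (\<lambda>x. R `` {x}))"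

lemma mem_aorb_base: "x \<in> aorb_base X \<phi> x"
  by (auto simp: aorb_base_def nbhds_of_def)

lemma image_mem_aorb_base: "\<phi> x \<in> aorb_base X \<phi> x"
  by (auto simp: aorb_base_def nbhds_of_def)

lemma open_nbhds_of_iff: "openin X U \<Longrightarrow> U \<in> nbhds_of X x \<longleftrightarrow> x \<in> U"
  using openin_subset[of X U] by (auto simp: nbhds_of_def)

text \<open>
  A set \<^term>\<open>F\<close> that contains an open set \<^term>\<open>U\<close> around \<^term>\<open>x\<close> is a neighborhood of
  \<^term>\<open>x\<close>; hence the approximating orbit is described by pure separation: \<^term>\<open>y\<close> lies outside
  it iff some saturated pair of an open and a larger closed set puts \<^term>\<open>y\<close> apart from
  \<^term>\<open>x\<close>.
\<close>

lemma mem_aorb_succ_iff: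
  "y \<in> aorb_succ X s x \<longleftrightarrow>
    (\<forall>U F. openin X U \<and> x \<in> U \<and> (\<Union>z\<in>U. s z) \<subseteq> U \<and>
       closedin X F \<and> U \<subseteq> F \<and> (\<Union>z\<in>F. s z) \<subseteq> F \<longrightarrow> y \<in> F)"
  (is "_ \<longleftrightarrow> ?R")
proof -
  have closure: "y \<in> sorb_closure X s x U \<longleftrightarrow>
      (\<forall>F. closedin X F \<and> U \<subseteq> F \<and> (\<Union>z\<in>F. s z) \<subseteq> F \<longrightarrow> y \<in> F)"
    if "openin X U" "x \<in> U" for U
  proof -
    have "F \<in> nbhds_of X x" if "U \<subseteq> F" "closedin X F" for F
      using that \<open>openin X U\<close> \<open>x \<in> U\<close> closedin_subset[of X F] by (auto simp: nbhds_of_def)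
    then show ?thesis by (auto simp: sorb_closure_def)
  qed
  have "y \<in> aorb_succ X s x \<longleftrightarrow>
    (\<forall>U. openin X U \<and> x \<in> U \<and> (\<Union>z\<in>U. s z) \<subseteq> U \<longrightarrow> y \<in> sorb_closure X s x U)"
    unfolding aorb_succ_def Inter_iff Ball_def mem_Collect_eq using open_nbhds_of_iff[of X _ x] by metis
  also have "\<dots> \<longleftrightarrow> (\<forall>U. openin X U \<and> x \<in> U \<and> (\<Union>z\<in>U. s z) \<subseteq> U \<longrightarrow>
      (\<forall>F. closedin X F \<and> U \<subseteq> F \<and> (\<Union>z\<in>F. s z) \<subseteq> F \<longrightarrow> y \<in> F))"
    by (intro all_cong1 imp_cong refl closure; elim conjE; assumption)
  also have "\<dots> \<longleftrightarrow> ?R" by (simp only: imp_conjL all_simps)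
  finally show ?thesis .
qed

lemma class_subset_aorb_succ: "s x \<subseteq> aorb_succ X s x"
  unfolding subset_iff mem_aorb_succ_iff by blast

lemma mem_aorb_succ: "x \<in> aorb_succ X s x"
  unfolding mem_aorb_succ_iff by blast

lemma subset_next_equiv:
  assumes "equiv (topspace X) R"
  shows "R \<subseteq> next_equiv X R"
proof (rule subrelI)
  fix x y assume xy: "(x, y) \<in> R"
  then have "x \<in> topspace X" "y \<in> topspace X" using assms by (auto simp: equiv_def)
  moreover have "y \<in> aorb_succ X (\<lambda>x. R `` {x}) x"
    using class_subset_aorb_succ[of "\<lambda>x. R `` {x}" x X] xy by blast
  ultimately show "(x, y) \<in> next_equiv X R"
    unfolding next_equiv_def by (intro generated_equiv_if_mem mem_aorb_succ)
qed

lemma fix_equiv_image: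
  "\<phi> \<in> topspace X \<rightarrow> topspace X \<Longrightarrow> x \<in> topspace X \<Longrightarrow> (x, \<phi> x) \<in> fix_equiv X \<phi>"
  by (auto simp: fix_equiv_def fix_koopman_iff)

text \<open>
  The sets are the preimages of an open ball and of the closed ball of the same radius under a
  separating invariant function. Being unions of classes, they are admissible in the base case and
  in every successor case of the recursion at once.
\<close>

lemma fix_equiv_separation:
  assumes x: "x \<in> topspace X" and y: "y \<in> topspace X" and ne: "(x, y) \<notin> fix_equiv X \<phi>"
  obtains V F where "openin X V" "closedin X F" "x \<in> V" "V \<subseteq> F" "y \<notin> F"
    "fix_equiv X \<phi> `` V \<subseteq> V" "fix_equiv X \<phi> `` F \<subseteq> F"
proof -
  obtain f where f: "f \<in> fix_koopman X \<phi>" "f x \<noteq> f y"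
    using x y ne unfolding fix_equiv_def by auto
  define \<epsilon> where "\<epsilon> = dist (f x) (f y) / 2"
  have \<epsilon>: "\<epsilon> > 0" "\<epsilon> < dist (f x) (f y)" using f(2) by (simp_all add: \<epsilon>_def)
  have cont: "continuous_map X euclidean f" using f(1) by (simp add: fix_koopman_iff)
  define V where "V = {z \<in> topspace X. f z \<in> ball (f x) \<epsilon>}"
  define F where "F = {z \<in> topspace X. f z \<in> cball (f x) \<epsilon>}"
  show thesis
  proof
    show "openin X V" unfolding V_def by (rule openin_continuous_map_preimage[OF cont]) simp
    show "closedin X F" unfolding F_def by (rule closedin_continuous_map_preimage[OF cont]) simp
    show "x \<in> V" "V \<subseteq> F" "y \<notin> F" using x \<epsilon> by (auto simp: V_def F_def)
    show "fix_equiv X \<phi> `` V \<subseteq> V" "fix_equiv X \<phi> `` F \<subseteq> F"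
      using f(1) by (auto simp: V_def F_def fix_equiv_def)
  qed
qed

lemma aorb_base_subset_fix_equiv:
  assumes x: "x \<in> topspace X" and \<phi>: "\<phi> \<in> topspace X \<rightarrow> topspace X"
  shows "aorb_base X \<phi> x \<subseteq> fix_equiv X \<phi> `` {x}"
proof
  fix y assume "y \<in> aorb_base X \<phi> x"
  then have y: "y \<in> F" if "openin X V" "x \<in> V" "V \<subseteq> F" "closedin X F" "\<phi> ` F \<subseteq> F" for V F
    using that closedin_subset[of X F] unfolding aorb_base_def nbhds_of_def by auto
  have yX: "y \<in> topspace X"
    by (rule y[of "topspace X"]) (use x \<phi> in auto)
  have "(x, y) \<in> fix_equiv X \<phi>"
  proof (rule ccontr)
    assume "(x, y) \<notin> fix_equiv X \<phi>"
    from fix_equiv_separation[OF x yX this] obtain V F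
      where VF: "openin X V" "closedin X F" "x \<in> V" "V \<subseteq> F" "y \<notin> F" "fix_equiv X \<phi> `` F \<subseteq> F" .
    have "\<phi> ` F \<subseteq> F"
    proof
      fix w assume "w \<in> \<phi> ` F"
      then obtain z where z: "z \<in> F" "w = \<phi> z" by blast
      then have "(z, w) \<in> fix_equiv X \<phi>"
        using fix_equiv_image[OF \<phi>] closedin_subset[OF VF(2)] by blast
      then show "w \<in> F" using z(1) VF(6) by blast
    qed
    with y VF show False by blast
  qed
  then show "y \<in> fix_equiv X \<phi> `` {x}" by simp
qed

lemma aorb_succ_subset_fix_equiv:
  assumes x: "x \<in> topspace X" and R: "R \<subseteq> fix_equiv X \<phi>"
  shows "aorb_succ X (\<lambda>x. R `` {x}) x \<subseteq> fix_equiv X \<phi> `` {x}"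
proof
  fix y assume "y \<in> aorb_succ X (\<lambda>x. R `` {x}) x"
  then have y: "y \<in> F"
    if "openin X V" "closedin X F" "x \<in> V" "V \<subseteq> F" "R `` V \<subseteq> V" "R `` F \<subseteq> F" for V F
    using that unfolding mem_aorb_succ_iff Image_eq_UN[symmetric] by simp
  have yX: "y \<in> topspace X"
    by (rule y[of "topspace X"]) (use x R in \<open>auto simp: fix_equiv_def\<close>)
  have "(x, y) \<in> fix_equiv X \<phi>"
  proof (rule ccontr)
    assume "(x, y) \<notin> fix_equiv X \<phi>"
    from fix_equiv_separation[OF x yX this] obtain V F
      where VF: "openin X V" "closedin X F" "x \<in> V" "V \<subseteq> F" "y \<notin> F"
        "fix_equiv X \<phi> `` V \<subseteq> V" "fix_equiv X \<phi> `` F \<subseteq> F" .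
    have "R `` V \<subseteq> V" "R `` F \<subseteq> F"
      using VF(6,7) Image_mono[OF R subset_refl] by blast+
    with y VF(1-5) show False by blast
  qed
  then show "y \<in> fix_equiv X \<phi> `` {x}" by simp
qed

text \<open>
  Stability turns non-equivalence of \<open>x\<close> and \<open>y\<close> into saturated sets \<open>U \<subseteq> F\<close>, with \<open>U\<close> open around
  \<open>x\<close> and \<open>F\<close> closed without \<open>y\<close>. The images of \<open>U\<close> and of the complement of \<open>F\<close> are disjoint open
  sets in the quotient.
\<close>

lemma next_equiv_stable_imp_Hausdorff:
  assumes R: "equiv (topspace X) R" and stable: "next_equiv X R \<subseteq> R"
  shows "Hausdorff_space (quotient_topology X R)"
  unfolding Hausdorff_space_def
proof (intro allI impI, elim conjE)
  let ?Q = "quotient_topology X R" and ?s = "\<lambda>x. R `` {x}"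
  fix a b assume "a \<in> topspace ?Q" "b \<in> topspace ?Q" and ne: "a \<noteq> b"
  then obtain x y where x: "x \<in> topspace X" "a = R `` {x}" and y: "y \<in> topspace X" "b = R `` {y}"
    by (auto simp: topspace_quotient_topology elim!: quotientE)
  have "(x, y) \<notin> R" using ne x y equiv_class_eq[OF R] by metis
  then have "y \<notin> aorb_succ X ?s x"
    using generated_equiv_if_mem[of x X y "aorb_succ X ?s"] x y stable mem_aorb_succ[of y X ?s]
    by (auto simp: next_equiv_def)
  then obtain U F where U: "x \<in> U" "openin X U" "(\<Union>z\<in>U. ?s z) \<subseteq> U"
    and F: "closedin X F" "U \<subseteq> F" "(\<Union>z\<in>F. ?s z) \<subseteq> F" "y \<notin> F"
    unfolding mem_aorb_succ_iff by blast
  (* Saturated sets are full preimages of their images, so their images are open when they are. *)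
  have sat: "{z \<in> topspace X. ?s z \<in> ?s ` W} = W"
    if "W \<subseteq> topspace X" "(\<Union>z\<in>W. ?s z) \<subseteq> W" for W
  proof -
    have "z \<in> W" if "z \<in> topspace X" "w \<in> W" "?s z = ?s w" for z w
      using that \<open>(\<Union>z\<in>W. ?s z) \<subseteq> W\<close> equiv_class_self[OF R, of z] by blast
    then show ?thesis using that(1) by blast
  qed
  have open_img: "openin ?Q (?s ` W)" if "openin X W" "(\<Union>z\<in>W. ?s z) \<subseteq> W" for W
    unfolding openin_quotient_topology
    using sat[OF openin_subset[OF that(1)] that(2)] that(1) openin_subset[OF that(1)]
    by (auto intro: quotientI)
  let ?G = "topspace X - F"
  have G: "(\<Union>z\<in>?G. ?s z) \<subseteq> ?G"
  proof -
    have "w \<in> ?G" if "z \<in> ?G" "(z, w) \<in> R" for z w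
    proof -
      have "(w, z) \<in> R" using R that(2) by (meson equiv_def symD)
      then show ?thesis using that R F(3) by (auto simp: equiv_def)
    qed
    then show ?thesis by blast
  qed
  have "disjnt (?s ` U) (?s ` ?G)"
  proof -
    have False if "u \<in> U" "z \<in> ?G" "?s u = ?s z" for u z
    proof -
      have "z \<in> ?s u" using that equiv_class_self[OF R, of z] by auto
      then show False using that U(3) F(2) by blast
    qed
    then show ?thesis unfolding disjnt_def by blast
  qed
  moreover have "openin ?Q (?s ` U)" "openin ?Q (?s ` ?G)"
    using open_img U G F(1) by auto
  moreover have "a \<in> ?s ` U" "b \<in> ?s ` ?G"
    using x y U(1) F(4) by auto
  ultimately show "\<exists>U V. openin ?Q U \<and> openin ?Q V \<and> a \<in> U \<and> b \<in> V \<and> disjnt U V" by blast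
qed

text \<open>
  A Urysohn function on the quotient, pulled back to the space, is constant on classes. Since each
  point is related to its image, the pullback is invariant.
\<close>

lemma fix_equiv_subset_stable_equiv:
  assumes comp: "compact_space X" and R: "equiv (topspace X) R" and stable: "next_equiv X R \<subseteq> R"
    and inv: "\<And>x. x \<in> topspace X \<Longrightarrow> (x, \<phi> x) \<in> R"
  shows "fix_equiv X \<phi> \<subseteq> R"
proof (rule subrelI, rule ccontr)
  fix x y assume xy: "(x, y) \<in> fix_equiv X \<phi>" "(x, y) \<notin> R"
  let ?Q = "quotient_topology X R" and ?q = "\<lambda>x. R `` {x}"
  have x: "x \<in> topspace X" and y: "y \<in> topspace X" using xy(1) by (simp_all add: fix_equiv_def)
  have q: "continuous_map X ?Q ?q"
    by (rule quotient_imp_continuous_map[OF quotient_map_quotient_topology])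
  have haus: "Hausdorff_space ?Q" by (rule next_equiv_stable_imp_Hausdorff[OF R stable])
  have "compactin ?Q (?q ` topspace X)"
    using image_compactin[OF _ q] comp by (simp add: compact_space_def)
  moreover have "?q ` topspace X = topspace ?Q"
    using quotient_map_quotient_topology[of X R] by (simp add: quotient_map_def)
  ultimately have compQ: "compact_space ?Q" by (simp add: compact_space_def)
  have qx: "?q x \<in> topspace ?Q" "?q y \<in> topspace ?Q"
    using x y by (simp_all add: topspace_quotient_topology quotientI)
  have "?q x \<noteq> ?q y" using xy(2) eq_equiv_class_iff[OF R x y] by simp
  then obtain f where f: "f \<in> cfun ?Q" "f (?q x) = 0" "f (?q y) = 1"
    using cfun_separates_closed[OF compQ haus closedin_Hausdorff_singleton[OF haus qx(2)] qx(1)]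
    by auto
  define g where "g z = (if z \<in> topspace X then f (?q z) else 0)" for z
  have "continuous_map ?Q euclidean f" using f(1) by (simp add: cfun_def)
  from continuous_map_compose[OF q this] have "continuous_map X euclidean (f \<circ> ?q)" .
  then have cont: "continuous_map X euclidean g"
    by (rule continuous_map_eq) (simp add: g_def)
  have "g (\<phi> z) = g z" if z: "z \<in> topspace X" for z
  proof -
    have "\<phi> z \<in> topspace X" using inv[OF z] R by (auto simp: equiv_def)
    moreover have "?q z = ?q (\<phi> z)" by (rule equiv_class_eq[OF R inv[OF z]])
    ultimately show ?thesis using z by (simp add: g_def)
  qed
  with cont have "g \<in> fix_koopman X \<phi>" by (simp add: fix_koopman_iff g_def)
  then have "g x = g y" using xy(1) by (simp add: fix_equiv_def)
  then show False using f(2,3) x y by (simp add: g_def)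
qed

section \<open>The transfinite recursion reaches the invariant functions\<close>

context
  fixes K :: "'a topology" and \<phi> :: "'a \<Rightarrow> 'a" and r :: "'o rel"
  assumes wo: "Well_order r" and \<phi>: "\<phi> \<in> topspace K \<rightarrow> topspace K"
begin

lemma sorb_eq_class: "sorb K \<phi> r \<gamma> = (\<lambda>x. orb_equiv K \<phi> r \<gamma> `` {x})"
  by (rule ext) (rule sorb_eq[OF wo])

lemma orb_equiv_successor:
  assumes "is_succ_of r \<gamma> \<beta>"
  shows "orb_equiv K \<phi> r \<gamma> = next_equiv K (orb_equiv K \<phi> r \<beta>)"
proof -
  have "aorb K \<phi> r \<gamma> = aorb_succ K (\<lambda>x. orb_equiv K \<phi> r \<beta> `` {x})"
    by (rule ext) (rule aorb_successor[OF wo assms, of K \<phi>, unfolded sorb_eq_class])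
  then show ?thesis by (simp add: orb_equiv_def[of K \<phi> r \<gamma>] next_equiv_def)
qed

lemma wo_induct_underS [consumes 0, case_names step]:
  assumes "\<And>\<gamma>. (\<And>\<beta>. \<beta> \<in> underS r \<gamma> \<Longrightarrow> P \<beta>) \<Longrightarrow> P \<gamma>"
  shows "P \<gamma>"
proof -
  have "wo_rel r" using wo by (simp add: wo_rel_def)
  then show ?thesis
    by (rule wo_rel.well_order_induct[of r P]) (rule assms, simp add: underS_def)
qed

text \<open>
  Both properties are proved in one induction: at a limit, the lower bound needs the relations of
  smaller degree to be reflexive, and the upper bound needs them to lie in \<^const>\<open>fix_equiv\<close>.
\<close>

lemma mem_aorb_and_aorb_subset_fix_equiv:
  "\<forall>x\<in>topspace K. x \<in> aorb K \<phi> r \<gamma> x \<and> aorb K \<phi> r \<gamma> x \<subseteq> fix_equiv K \<phi> `` {x}"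
proof (induction \<gamma> rule: wo_induct_underS)
  case (step \<gamma>)
  have eqv: "equiv (topspace K) (orb_equiv K \<phi> r \<beta>)" if "\<beta> \<in> underS r \<gamma>" for \<beta>
    unfolding orb_equiv_def using step[OF that] by (intro equiv_generated_equiv) blast
  have sub: "orb_equiv K \<phi> r \<beta> \<subseteq> fix_equiv K \<phi>" if "\<beta> \<in> underS r \<gamma>" for \<beta>
    unfolding orb_equiv_def using step[OF that] by (intro generated_equiv_least equiv_fix_equiv) blast
  show ?case
  proof
    fix x assume x: "x \<in> topspace K"
    consider "underS r \<gamma> = {}" | \<beta> where "is_succ_of r \<gamma> \<beta>"
      | "underS r \<gamma> \<noteq> {}" "\<nexists>\<beta>. is_succ_of r \<gamma> \<beta>" by blast
    then show "x \<in> aorb K \<phi> r \<gamma> x \<and> aorb K \<phi> r \<gamma> x \<subseteq> fix_equiv K \<phi> `` {x}"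
    proof cases
      case 1
      then show ?thesis
        using aorb_base_subset_fix_equiv[OF x \<phi>] mem_aorb_base[of x K \<phi>] by (simp add: aorb_zero)
    next
      case 2
      then have "\<beta> \<in> underS r \<gamma>" by (simp add: is_succ_of_def)
      then show ?thesis
        unfolding aorb_successor[OF wo 2] sorb_eq_class
        using aorb_succ_subset_fix_equiv[OF x sub] mem_aorb_succ by simp
    next
      case 3
      then obtain \<beta> where "\<beta> \<in> underS r \<gamma>" by blast
      then have "x \<in> orb_equiv K \<phi> r \<beta> `` {x}" using equiv_class_self[OF eqv x] by blast
      with \<open>\<beta> \<in> underS r \<gamma>\<close> sub show ?thesis
        unfolding aorb_limit[OF 3] sorb_eq_class by blast
    qed
  qed
qed

lemma equiv_orb_equiv: "equiv (topspace K) (orb_equiv K \<phi> r \<gamma>)"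
  unfolding orb_equiv_def using mem_aorb_and_aorb_subset_fix_equiv
  by (intro equiv_generated_equiv) blast

lemma orb_equiv_subset_fix_equiv: "orb_equiv K \<phi> r \<gamma> \<subseteq> fix_equiv K \<phi>"
  unfolding orb_equiv_def using mem_aorb_and_aorb_subset_fix_equiv
  by (intro generated_equiv_least equiv_fix_equiv) blast

lemma orb_equiv_limit_mono:
  assumes "\<nexists>\<beta>. is_succ_of r \<gamma> \<beta>" "\<beta> \<in> underS r \<gamma>"
  shows "orb_equiv K \<phi> r \<beta> \<subseteq> orb_equiv K \<phi> r \<gamma>"
proof (rule subrelI)
  fix x y assume xy: "(x, y) \<in> orb_equiv K \<phi> r \<beta>"
  then have X: "x \<in> topspace K" "y \<in> topspace K" using equiv_orb_equiv[of \<beta>] by (auto simp: equiv_def)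
  have ne: "underS r \<gamma> \<noteq> {}" using assms(2) by blast
  have "y \<in> aorb K \<phi> r \<gamma> x" "y \<in> aorb K \<phi> r \<gamma> y"
    unfolding aorb_limit[OF ne assms(1)] sorb_eq_class
    using xy assms(2) equiv_class_self[OF equiv_orb_equiv X(2)] by blast+
  with X show "(x, y) \<in> orb_equiv K \<phi> r \<gamma>"
    unfolding orb_equiv_def[of K \<phi> r \<gamma>] by (intro generated_equiv_if_mem)
qed

text \<open>
  Monotonicity of the recursion in a form that mentions the successor step of \<open>\<beta>\<close> instead of the
  relation of degree \<open>\<beta>\<close>: this is what makes the new pairs of different degrees distinct.
  If \<open>\<gamma>\<close> is not a successor, some \<open>\<delta>\<close> lies strictly between \<open>\<beta>\<close> and \<open>\<gamma>\<close>.
\<close>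

lemma next_equiv_subset_orb_equiv:
  "\<beta> \<in> underS r \<gamma> \<Longrightarrow> next_equiv K (orb_equiv K \<phi> r \<beta>) \<subseteq> orb_equiv K \<phi> r \<gamma>"
proof (induction \<gamma> arbitrary: \<beta> rule: wo_induct_underS)
  case (step \<gamma>)
  have wo': "wo_rel r" using wo by (simp add: wo_rel_def)
  show ?case
  proof (cases "\<exists>\<delta>. is_succ_of r \<gamma> \<delta>")
    case True
    then obtain \<delta> where \<delta>: "is_succ_of r \<gamma> \<delta>" by blast
    show ?thesis
    proof (cases "\<beta> = \<delta>")
      case True
      then show ?thesis using orb_equiv_successor[OF \<delta>] by simp
    next
      case False
      then have "\<beta> \<in> underS r \<delta>" "\<delta> \<in> underS r \<gamma>"
        using \<delta> step.prems by (auto simp: is_succ_of_def underS_def)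
      then have "next_equiv K (orb_equiv K \<phi> r \<beta>) \<subseteq> orb_equiv K \<phi> r \<delta>" using step.IH by blast
      also have "\<dots> \<subseteq> orb_equiv K \<phi> r \<gamma>"
        unfolding orb_equiv_successor[OF \<delta>] by (rule subset_next_equiv[OF equiv_orb_equiv])
      finally show ?thesis .
    qed
  next
    case False
    then obtain \<delta> where \<delta>: "\<delta> \<in> underS r \<gamma>" "(\<delta>, \<beta>) \<notin> r"
      using step.prems by (auto simp: is_succ_of_def)
    then have "\<beta> \<in> underS r \<delta>"
      using step.prems wo_rel.TOTALS[OF wo'] wo_rel.REFL[OF wo']
      by (auto simp: underS_def Field_def refl_on_def)
    then have "next_equiv K (orb_equiv K \<phi> r \<beta>) \<subseteq> orb_equiv K \<phi> r \<delta>" using step.IH \<delta>(1) by blast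
    also have "\<dots> \<subseteq> orb_equiv K \<phi> r \<gamma>" by (rule orb_equiv_limit_mono[OF False \<delta>(1)])
    finally show ?thesis .
  qed
qed

lemma image_related:
  assumes x: "x \<in> topspace K"
  shows "(x, \<phi> x) \<in> orb_equiv K \<phi> r \<gamma>"
proof (induction \<gamma> rule: wo_induct_underS)
  case (step \<gamma>)
  show ?case
  proof (cases "underS r \<gamma> = {}")
    case True
    then show ?thesis
      unfolding orb_equiv_def using x \<phi>
      by (intro generated_equiv_if_mem) (auto simp: aorb_zero image_mem_aorb_base mem_aorb_base)
  next
    case False
    then obtain \<beta> where "\<beta> \<in> underS r \<gamma>" by blast
    then show ?thesis
      using step next_equiv_subset_orb_equiv subset_next_equiv[OF equiv_orb_equiv] by blast
  qed
qed

text \<open>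
  If no degree worked, each \<open>\<gamma>\<close> would have a pair that the successor step adds to the relation of
  degree \<open>\<gamma>\<close>. Such a pair belongs to every larger degree, so the pairs chosen for different
  degrees differ, and choosing them is an injection of the index set into the pairs of points.
\<close>

lemma orb_equiv_reaches_fix_equiv:
  assumes comp: "compact_space K"
    and large: "\<And>p :: 'o \<Rightarrow> 'a \<times> 'a. \<not> inj_on p (Field r)"
  shows "\<exists>\<alpha>\<in>Field r. orb_equiv K \<phi> r \<alpha> = fix_equiv K \<phi>"
proof (rule ccontr)
  assume neg: "\<not> ?thesis"
  have "\<exists>p. p \<in> next_equiv K (orb_equiv K \<phi> r \<gamma>) \<and> p \<notin> orb_equiv K \<phi> r \<gamma>" if "\<gamma> \<in> Field r" for \<gamma>
  proof (rule ccontr)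
    assume "\<not> ?thesis"
    then have "next_equiv K (orb_equiv K \<phi> r \<gamma>) \<subseteq> orb_equiv K \<phi> r \<gamma>" by blast
    then have "fix_equiv K \<phi> \<subseteq> orb_equiv K \<phi> r \<gamma>"
      by (rule fix_equiv_subset_stable_equiv[OF comp equiv_orb_equiv]) (rule image_related)
    with neg that orb_equiv_subset_fix_equiv show False by blast
  qed
  then obtain p where p: "\<And>\<gamma>. \<gamma> \<in> Field r \<Longrightarrow> p \<gamma> \<in> next_equiv K (orb_equiv K \<phi> r \<gamma>)"
    "\<And>\<gamma>. \<gamma> \<in> Field r \<Longrightarrow> p \<gamma> \<notin> orb_equiv K \<phi> r \<gamma>" by metis
  have ne: "p \<beta> \<noteq> p \<gamma>" if "\<beta> \<in> underS r \<gamma>" for \<beta> \<gamma>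
  proof -
    have "\<beta> \<in> Field r" "\<gamma> \<in> Field r" using that by (auto simp: underS_def Field_def)
    then show ?thesis using p next_equiv_subset_orb_equiv[OF that] by (metis subsetD)
  qed
  have "inj_on p (Field r)"
  proof (rule inj_onI, rule ccontr)
    fix \<beta> \<gamma> assume "\<beta> \<in> Field r" "\<gamma> \<in> Field r" "p \<beta> = p \<gamma>" "\<beta> \<noteq> \<gamma>"
    moreover have "wo_rel r" using wo by (simp add: wo_rel_def)
    ultimately have "\<beta> \<in> underS r \<gamma> \<or> \<gamma> \<in> underS r \<beta>"
      using wo_rel.TOTALS by (fastforce simp: underS_def)
    with ne \<open>p \<beta> = p \<gamma>\<close> show False by metis
  qed
  with large show False by blast
qed

end

theorem theorem4p6:
  fixes K :: "'a topology" and L :: "'b topology" and \<phi> :: "'a \<Rightarrow> 'a"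
  assumes "compact_space K" and "Hausdorff_space K"
    and "continuous_map K K \<phi>"
    and "compact_space L" and "Hausdorff_space L"
    and "star_isomorphic (fix_koopman K \<phi>) (cfun L)"
  shows "\<exists>(r :: 'a rel rel) \<alpha>. Well_order r \<and> \<alpha> \<in> Field r \<and>
           L homeomorphic_space quotient_topology K (orb_equiv K \<phi> r \<alpha>)"
proof -
  obtain r :: "'a rel rel" where r: "Well_order r" "Field r = UNIV"
    using well_ordering by (elim exE conjE)
  have \<phi>: "\<phi> \<in> topspace K \<rightarrow> topspace K" using assms(3) by (rule continuous_map_funspace)
  have "\<not> inj_on p (Field r)" for p :: "'a rel \<Rightarrow> 'a \<times> 'a"
  proof
    assume "inj_on p (Field r)"
    then have "inj p" by (simp only: r(2))
    then have "surj (inv p)" by (rule inj_imp_surj_inv)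
    then have "inv p ` UNIV = Pow UNIV" by (simp only: Pow_UNIV)
    then have "\<exists>f. f ` (UNIV :: ('a \<times> 'a) set) = Pow (UNIV :: ('a \<times> 'a) set)" by (rule exI[of _ "inv p"])
    with Cantors_theorem show False by (rule notE)
  qed
  from orb_equiv_reaches_fix_equiv[OF r(1) \<phi> assms(1) this]
  obtain \<alpha> where \<alpha>: "\<alpha> \<in> Field r" "orb_equiv K \<phi> r \<alpha> = fix_equiv K \<phi>" by (elim bexE)
  have "L homeomorphic_space quotient_topology K (orb_equiv K \<phi> r \<alpha>)"
    unfolding \<alpha>(2) by (rule gelfand_space_homeomorphic_quotient[OF assms(1) \<phi> assms(4,5,6)])
  with r(1) \<alpha>(1) show ?thesis by (intro exI[of _ r] exI[of _ \<alpha>] conjI)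
qed

end
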